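(* Suppose $U=1$, $h=K=0$, and $H=\infty$. There exist absolute constants $C>0$ and $T_0\in\mathbb{Z}_{>0}$ such that for any $b\in(0,1/2]$, $L\in\mathbb{Z}_{\ge 0}$, $T\in\mathbb{Z}_{\ge T_0}$, $\gamma\in[0,b/16]$, and $\underline{H}\le -1$, the class $\mathcal{L}(\Pi_{(s,S)})=\{\ell((s,S),\cdot):(s,S)\in\Pi_{(s,S)}\}$ of loss functions induced by $\Pi_{(s,S)}=\{(s,S)\in\mathbb{R}^2:\underline{H}\le s\le S,\ S\ge 0\}$ satisfies $$\mathrm{P}_{\gamma}\text{-}\mathrm{dim}\big(\mathcal{L}(\Pi_{(s,S)})\big)\ge C\,\frac{\log T}{\log\log T}.$$
   Context: Inventory model (backlogged demand, lead time $L$). There are $T+L$ periods; a demand sequence is $\mathbf{d}=(d^1,\dots,d^{T+L})\in[0,U]^{T+L}$. Let $x^t$ be the inventory level at the beginning of period $t$ and $q^t\ge 0$ the quantity ordered in period $t$ (arriving in period $t+L$), with $q^t=0$ for $t\le 0$. The inventory position before ordering is $I^t=x^t+\sum_{t'=t-L}^{t-1}q^{t'}$. After replenishment the inventory level is $y^t=x^t+q^{t-L}$, and $x^{t+1}=y^t-d^t$. Let $c(x)=h\max\{x,0\}+b\max\{-x,0\}$. The loss in period $t$ of a policy $\pi$ is $\ell^t(\pi,\mathbf{d})=c(y^t-d^t)+K\cdot\mathbb{I}\{q^{t-L}>0\}$, and the loss is $\ell(\pi,\mathbf{d})=\frac1T\sum_{t=L+1}^{T+L}\ell^t(\pi,\mathbf{d})$.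 $(s,S)$ policies: in general $\Pi_{(s,S)}=\{(s,S):\underline{H}\le s\le S\le H,\ S\ge0\}$; the policy $(s,S)$ orders $q^t=(S-I^t)\cdot\mathbb{I}\{I^t\le s\}$ in every period $t\ge 1$. The initial level $x^1$ is a fixed non-positive constant with $x^1\le\underline{H}$. Pseudo$_\gamma$-dimension: for $\gamma\ge 0$, a dataset $(\mathbf{d}_i)_{i=1}^m$ in $[0,U]^{T+L}$ is $\gamma$-shattered by a class $\{f(\pi,\cdot):\pi\in\Pi\}$ of real-valued functions if there exist $\tau_1,\dots,\tau_m\in\mathbb{R}$ such that for every $A\subseteq\{1,\dots,m\}$ there is $\pi\in\Pi$ with $f(\pi,\mathbf{d}_i)>\tau_i+\gamma$ for all $i\in A$ and $f(\pi,\mathbf{d}_i)\le\tau_i-\gamma$ for all $i\notin A$. $\mathrm{P}_\gamma\text{-}\mathrm{dim}$ is the maximum size of a dataset that can be $\gamma$-shattered. *)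

theory Defs
  imports Complex_Main "HOL-Library.Extended_Real" "HOL-Library.FuncSet"
begin

text \<open>
  Periods are natural numbers starting at 1. Truncated subtraction sends every period \<open>t \<le> 0\<close>
  to 0, where the ordered quantity is 0; the inventory level at period 0 is a dummy value.
  A policy \<open>p\<close> maps the inventory position before ordering to the ordered quantity.
\<close>

function inv_level :: "nat \<Rightarrow> real \<Rightarrow> (real \<Rightarrow> real) \<Rightarrow> (nat \<Rightarrow> real) \<Rightarrow> nat \<Rightarrow> real"
  and order_qty :: "nat \<Rightarrow> real \<Rightarrow> (real \<Rightarrow> real) \<Rightarrow> (nat \<Rightarrow> real) \<Rightarrow> nat \<Rightarrow> real" where
  "inv_level L x1 p d t =
     (if t \<le> 1 then x1
      else inv_level L x1 p d (t - 1) + order_qty L x1 p d (t - 1 - L) - d (t - 1))"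
| "order_qty L x1 p d t =
     (if t = 0 then 0
      else p (inv_level L x1 p d t + (\<Sum>t'\<in>{t - L..<t}. order_qty L x1 p d t')))"
  by pat_completeness auto
termination
  by (relation "measure (case_sum (\<lambda>(L, x1, p, d, t). 2 * t) (\<lambda>(L, x1, p, d, t). 2 * t + 1))") auto

declare inv_level.simps [simp del] order_qty.simps [simp del]

definition replenished_level ::
    "nat \<Rightarrow> real \<Rightarrow> (real \<Rightarrow> real) \<Rightarrow> (nat \<Rightarrow> real) \<Rightarrow> nat \<Rightarrow> real" where
  "replenished_level L x1 p d t = inv_level L x1 p d t + order_qty L x1 p d (t - L)"

definition holding_backlog_cost :: "real \<Rightarrow> real \<Rightarrow> real \<Rightarrow> real" where
  "holding_backlog_cost h b x = h * max x 0 + b * max (- x) 0"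

definition period_loss ::
    "nat \<Rightarrow> real \<Rightarrow> real \<Rightarrow> real \<Rightarrow> real \<Rightarrow> (real \<Rightarrow> real) \<Rightarrow> (nat \<Rightarrow> real) \<Rightarrow> nat \<Rightarrow> real" where
  "period_loss L h b K x1 p d t =
     holding_backlog_cost h b (replenished_level L x1 p d t - d t)
       + K * of_bool (order_qty L x1 p d (t - L) > 0)"

definition loss ::
    "nat \<Rightarrow> nat \<Rightarrow> real \<Rightarrow> real \<Rightarrow> real \<Rightarrow> real \<Rightarrow> (real \<Rightarrow> real) \<Rightarrow> (nat \<Rightarrow> real) \<Rightarrow> real" where
  "loss L T h b K x1 p d = (1 / real T) * (\<Sum>t = L + 1..T + L. period_loss L h b K x1 p d t)"

definition demand_seqs :: "nat \<Rightarrow> nat \<Rightarrow> real \<Rightarrow> (nat \<Rightarrow> real) set" where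
  "demand_seqs L T U = {1..T + L} \<rightarrow>\<^sub>E {0..U}"

definition sS_policy :: "real \<times> real \<Rightarrow> real \<Rightarrow> real" where
  "sS_policy = (\<lambda>(s, S) I. (S - I) * of_bool (I \<le> s))"

definition sS_params :: "real \<Rightarrow> ereal \<Rightarrow> (real \<times> real) set" where
  "sS_params Hlow H = {(s, S). Hlow \<le> s \<and> s \<le> S \<and> ereal S \<le> H \<and> 0 \<le> S}"

definition sS_loss_class ::
    "nat \<Rightarrow> nat \<Rightarrow> real \<Rightarrow> real \<Rightarrow> real \<Rightarrow> real \<Rightarrow> real \<Rightarrow> ereal \<Rightarrow> ((nat \<Rightarrow> real) \<Rightarrow> real) set" where
  "sS_loss_class L T h b K x1 Hlow H =
     (\<lambda>\<pi>. loss L T h b K x1 (sS_policy \<pi>)) ` sS_params Hlow H"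

definition gamma_shattered :: "real \<Rightarrow> ('x \<Rightarrow> real) set \<Rightarrow> nat \<Rightarrow> (nat \<Rightarrow> 'x) \<Rightarrow> bool" where
  "gamma_shattered \<gamma> F m ds \<longleftrightarrow>
     (\<exists>\<tau> :: nat \<Rightarrow> real. \<forall>A \<subseteq> {1..m}. \<exists>f\<in>F.
        (\<forall>i\<in>A. f (ds i) > \<tau> i + \<gamma>) \<and> (\<forall>i\<in>{1..m} - A. f (ds i) \<le> \<tau> i - \<gamma>))"

text \<open>The supremum in \<^typ>\<open>enat\<close> is the maximum whenever the sizes are bounded, and
  \<open>\<infinity>\<close> otherwise.\<close>

definition pseudo_gamma_dim :: "real \<Rightarrow> 'x set \<Rightarrow> ('x \<Rightarrow> real) set \<Rightarrow> enat" where
  "pseudo_gamma_dim \<gamma> X F =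
     Sup {enat m | m. \<exists>ds. (\<forall>i\<in>{1..m}. ds i \<in> X) \<and> gamma_shattered \<gamma> F m ds}"

end

theory Submission imports Defs
begin

text \<open>
  Only the policies with \<open>S = 0\<close> and \<open>s = -\<Delta>\<close> are needed. Under such a policy the backlog of a
  period is the demand of a window of length \<open>L + 1\<close>, which does not depend on \<open>\<Delta>\<close>, plus the demand
  that has accumulated since the last order (the debt), which is cleared as soon as it reaches
  \<open>\<Delta>\<close>. For \<open>\<Delta> \<in> (3/4, 1]\<close> a block of four demands built from a number \<open>\<kappa>\<close> acts on the debts
  \<open>0\<close> and \<open>1/2\<close>: it exchanges them if \<open>\<Delta> > \<kappa>\<close>, and it leads to \<open>1/2\<close> in any case if \<open>\<Delta> \<le> \<kappa>\<close>.
  Running through decreasing values of \<open>\<kappa>\<close> therefore assigns any prescribed pattern of the debts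
  \<open>0\<close> and \<open>1/2\<close> to \<open>2\<^sup>m\<close> thresholds \<open>\<Delta>\<close> within \<open>O(2\<^sup>m)\<close> periods. Zero demand freezes the
  debt from then on, so that it dominates the average as soon as \<open>T\<close> is a large multiple of \<open>2\<^sup>m\<close>.
  This even shatters a number of demand sequences of order \<open>log T\<close>.
\<close>

section \<open>Inventory position\<close>

definition inv_position :: "nat \<Rightarrow> real \<Rightarrow> (real \<Rightarrow> real) \<Rightarrow> (nat \<Rightarrow> real) \<Rightarrow> nat \<Rightarrow> real" where
  "inv_position L x1 p d t = inv_level L x1 p d t + (\<Sum>t'\<in>{t - L..<t}. order_qty L x1 p d t')"

lemma order_qty_0 [simp]: "order_qty L x1 p d 0 = 0"
  by (subst order_qty.simps) simp

lemma order_qty_eq: "t \<ge> 1 \<Longrightarrow> order_qty L x1 p d t = p (inv_position L x1 p d t)"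
  by (subst order_qty.simps) (simp add: inv_position_def)

lemma inv_position_1: "inv_position L x1 p d 1 = x1"
proof -
  have "inv_level L x1 p d 1 = x1"
    by (subst inv_level.simps) simp
  moreover have "(\<Sum>t'\<in>{1 - L..<1}. order_qty L x1 p d t') = 0"
    by (intro sum.neutral) auto
  ultimately show ?thesis
    by (simp add: inv_position_def)
qed

text \<open>The order arriving in period \<open>t\<close> leaves the pipeline sum and enters the
  level, so the lead time cancels.\<close>

lemma inv_position_Suc:
  assumes "t \<ge> 1"
  shows "inv_position L x1 p d (Suc t) = inv_position L x1 p d t + order_qty L x1 p d t - d t"
proof -
  let ?q = "order_qty L x1 p d"
  have lev: "inv_level L x1 p d (Suc t) = inv_level L x1 p d t + ?q (t - L) - d t"
    using assms by (subst inv_level.simps) simp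
  have "?q (t - L) + sum ?q {Suc t - L..<Suc t} = sum ?q {t - L..<Suc t}"
  \<comment> \<open>For \<open>L > t\<close>, truncation makes both windows start at 0, and the
    arriving order is \<open>?q 0 = 0\<close>.\<close>
  proof (cases "L \<le> t")
    case True
    then have "Suc t - L = Suc (t - L)" "t - L < Suc t"
      by auto
    then show ?thesis
      using sum.atLeast_Suc_lessThan[of "t - L" "Suc t" ?q] by metis
  qed simp
  then show ?thesis
    unfolding inv_position_def lev by (simp add: sum.atLeastLessThan_Suc[of "t - L" t ?q] del: sum.op_ivl_Suc)
qed

text \<open>Exactly the orders placed by period \<open>u\<close> have arrived after the
  replenishment of period \<open>u + L\<close>.\<close>

lemma replenished_level_add_lead_time:
  assumes "u \<ge> 1"
  shows "replenished_level L x1 p d (u + L) =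
    inv_position L x1 p d u + order_qty L x1 p d u - (\<Sum>t\<in>{u..<u + L}. d t)"
proof -
  have "inv_position L x1 p d (u + k) =
      inv_position L x1 p d u + (\<Sum>t\<in>{u..<u + k}. order_qty L x1 p d t) - (\<Sum>t\<in>{u..<u + k}. d t)" for k
    using assms by (induction k) (simp_all add: inv_position_Suc)
  from this[of L] show ?thesis
    by (simp add: replenished_level_def inv_position_def)
qed

section \<open>Debt of the policies with \<open>S = 0\<close>\<close>

definition debt_step :: "real \<Rightarrow> real \<Rightarrow> real \<Rightarrow> real" where
  "debt_step \<Delta> c x = (if \<Delta> \<le> c + x then 0 else c + x)"

definition debt :: "real \<Rightarrow> (nat \<Rightarrow> real) \<Rightarrow> nat \<Rightarrow> real" where
  "debt \<Delta> d n = foldl (debt_step \<Delta>) 0 (map d [1..<Suc n])"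

lemma debt_0 [simp]: "debt \<Delta> d 0 = 0"
  by (simp add: debt_def)

lemma debt_Suc: "debt \<Delta> d (Suc n) = debt_step \<Delta> (debt \<Delta> d n) (d (Suc n))"
  by (simp add: debt_def)

lemma debt_bounds:
  assumes "\<Delta> > 0" "\<And>t. t \<in> {1..n} \<Longrightarrow> d t \<ge> 0"
  shows "0 \<le> debt \<Delta> d n \<and> debt \<Delta> d n < \<Delta>"
  using assms by (induction n) (auto simp: debt_Suc debt_step_def)

text \<open>Since \<open>x1 \<le> - \<Delta>\<close>, the position is raised to 0 already in period
  1. This erases the starting level, so the debt starts at 0.\<close>

lemma inv_position_order_up_to_0:
  assumes "x1 \<le> - \<Delta>"
  shows "inv_position L x1 (sS_policy (- \<Delta>, 0)) d (Suc n)
    + order_qty L x1 (sS_policy (- \<Delta>, 0)) d (Suc n) = - debt \<Delta> d n"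
proof (induction n)
  case 0
  then show ?case
    using assms inv_position_1[of L x1 "sS_policy (- \<Delta>, 0)" d]
    by (simp add: order_qty_eq sS_policy_def)
next
  case (Suc n)
  let ?p = "sS_policy (- \<Delta>, 0)"
  have "inv_position L x1 ?p d (Suc (Suc n)) = - debt \<Delta> d n - d (Suc n)"
    using Suc by (subst inv_position_Suc) simp_all
  then show ?case
    by (auto simp: order_qty_eq sS_policy_def debt_Suc debt_step_def)
qed

text \<open>The net level is never positive, so the cost is linear. Only the debt sum depends on
  \<open>\<Delta>\<close>; the window sum can be absorbed into the shattering levels.\<close>

lemma loss_order_up_to_0:
  assumes "x1 \<le> - \<Delta>" "\<Delta> > 0" "\<And>t. t \<in> {1..T + L} \<Longrightarrow> d t \<ge> 0"
  shows "loss L T 0 b 0 x1 (sS_policy (- \<Delta>, 0)) d =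
    b / real T * ((\<Sum>n<T. \<Sum>t\<in>{Suc n..Suc n + L}. d t) + (\<Sum>n<T. debt \<Delta> d n))"
proof -
  let ?p = "sS_policy (- \<Delta>, 0)"
  have per: "period_loss L 0 b 0 x1 ?p d (Suc n + L) =
      b * ((\<Sum>t\<in>{Suc n..Suc n + L}. d t) + debt \<Delta> d n)" if "n < T" for n
  proof -
    have "replenished_level L x1 ?p d (Suc n + L) = - debt \<Delta> d n - (\<Sum>t\<in>{Suc n..<Suc n + L}. d t)"
      using inv_position_order_up_to_0[OF assms(1), of L d n] by (subst replenished_level_add_lead_time) simp_all
    moreover have "(\<Sum>t\<in>{Suc n..Suc n + L}. d t) = (\<Sum>t\<in>{Suc n..<Suc n + L}. d t) + d (Suc n + L)"
      using sum.atLeastLessThan_Suc[of "Suc n" "Suc n + L" d] by (simp add: atLeastLessThanSuc_atLeastAtMost)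
    ultimately have eq: "replenished_level L x1 ?p d (Suc n + L) - d (Suc n + L) =
        - ((\<Sum>t\<in>{Suc n..Suc n + L}. d t) + debt \<Delta> d n)"
      by simp
    have "0 \<le> (\<Sum>t\<in>{Suc n..Suc n + L}. d t)"
      using that by (intro sum_nonneg assms) auto
    moreover have "0 \<le> debt \<Delta> d n"
      using that debt_bounds[of \<Delta> n d] assms by auto
    ultimately show ?thesis
      unfolding period_loss_def holding_backlog_cost_def eq by simp
  qed
  have "(\<Sum>t = L + 1..T + L. period_loss L 0 b 0 x1 ?p d t) =
      (\<Sum>n<T. period_loss L 0 b 0 x1 ?p d (Suc n + L))"
    by (rule sum.reindex_bij_witness[of _ "\<lambda>n. Suc n + L" "\<lambda>t. t - Suc L"]) auto
  also have "\<dots> = (\<Sum>n<T. b * ((\<Sum>t\<in>{Suc n..Suc n + L}. d t) + debt \<Delta> d n))"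
    using per by (intro sum.cong) auto
  also have "\<dots> = b * ((\<Sum>n<T. \<Sum>t\<in>{Suc n..Suc n + L}. d t) + (\<Sum>n<T. debt \<Delta> d n))"
    by (simp only: sum_distrib_left[symmetric] sum.distrib)
  finally show ?thesis
    by (simp add: loss_def)
qed

section \<open>Demands that realize a prescribed pattern\<close>

definition toggle_block :: "real \<Rightarrow> real list" where
  "toggle_block \<kappa> = [\<kappa> - 1/2, 1 - \<kappa>, \<kappa>, 1/2]"

text \<open>From 0 the debts are \<open>\<kappa> - 1/2\<close>, \<open>1/2\<close>,
  \<open>0\<close>, \<open>1/2\<close>. From \<open>1/2\<close> they are \<open>\<kappa>\<close>,
  \<open>0\<close>, \<open>\<kappa>\<close>, \<open>0\<close> if \<open>\<kappa> < \<Delta>\<close>,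
  and \<open>0\<close>, \<open>1 - \<kappa>\<close>, \<open>0\<close>, \<open>1/2\<close>
  otherwise.\<close>

lemma foldl_debt_step_toggle_block:
  assumes "3/4 \<le> \<kappa>" "\<kappa> \<le> 1" "3/4 < \<Delta>" "\<Delta> \<le> 1"
  shows "foldl (debt_step \<Delta>) (if hi then 1/2 else 0) (toggle_block \<kappa>) =
    (if \<kappa> < \<Delta> \<and> hi then 0 else 1/2)"
  using assms by (auto simp: toggle_block_def debt_step_def)

text \<open>Indices \<open>1..M\<close> give the thresholds \<open>\<Delta>\<close>, indices
  \<open>0..M - 1\<close> the parameters \<open>\<kappa>\<close> of the blocks.\<close>

definition grid :: "nat \<Rightarrow> nat \<Rightarrow> real" where
  "grid M n = 3/4 + real n / (4 * real M)"

lemma grid_bounds: "n \<le> M \<Longrightarrow> 3/4 \<le> grid M n \<and> grid M n \<le> 1"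
  by (cases "M = 0") (auto simp: grid_def field_simps)

lemma grid_less_iff: "M > 0 \<Longrightarrow> grid M k < grid M n \<longleftrightarrow> k < n"
  by (simp add: grid_def divide_less_cancel)

text \<open>
  The block of \<open>k\<close> separates the thresholds with index at least \<open>k\<close> from the smaller ones; it is
  replaced by zero demands if the pattern \<open>F\<close> does not change between \<open>k - 1\<close> and \<open>k\<close>.
\<close>

definition change_block :: "nat \<Rightarrow> (nat \<Rightarrow> bool) \<Rightarrow> nat \<Rightarrow> real list" where
  "change_block M F k = (if F k = F (k - 1) then [0, 0, 0, 0] else toggle_block (grid M (k - 1)))"

text \<open>The first demand brings the debt to \<open>1/2\<close> for every threshold; the blocks
  then come in the order \<open>k = M, M - 1, ...\<close>.\<close>

fun pattern_demands :: "nat \<Rightarrow> (nat \<Rightarrow> bool) \<Rightarrow> nat \<Rightarrow> real list" where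
  "pattern_demands M F 0 = [1/2]"
| "pattern_demands M F (Suc r) = pattern_demands M F r @ change_block M F (M - r)"

lemma length_pattern_demands: "length (pattern_demands M F r) = 4 * r + 1"
  by (induction r) (auto simp: change_block_def toggle_block_def)

lemma set_pattern_demands: "set (pattern_demands M F r) \<subseteq> {0..1}"
proof (induction r)
  case (Suc r)
  have "set (change_block M F (M - r)) \<subseteq> {0..1}"
    using grid_bounds[of "M - r - 1" M] by (auto simp: change_block_def toggle_block_def)
  with Suc show ?case
    by simp
qed simp

text \<open>Invariant: thresholds not yet separated share the debt \<open>1/2\<close>; for the
  others the debt records agreement with \<open>F (M - r)\<close>. When \<open>F\<close> changes,
  agreement flips for every separated index, which is what the toggle does.\<close>

lemma foldl_debt_step_pattern_demands:
  assumes n: "n \<in> {1..M}" and r: "r \<le> M"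
  shows "foldl (debt_step (grid M n)) 0 (pattern_demands M F r) =
    (if n \<le> M - r \<or> F n = F (M - r) then 1/2 else 0)"
  using r
proof (induction r)
  case 0
  then show ?case
    using n grid_bounds[of n M] by (auto simp: debt_step_def)
next
  case (Suc r)
  define k where "k = M - r"
  define hi where "hi \<longleftrightarrow> n \<le> k \<or> F n = F k"
  have k: "k \<ge> 1" "k \<le> M" "M - Suc r = k - 1"
    using Suc.prems by (auto simp: k_def)
  have \<Delta>: "3/4 < grid M n" "grid M n \<le> 1"
    using grid_bounds[of n M] n by (auto simp: grid_def)
  have less: "grid M (k - 1) < grid M n \<longleftrightarrow> k \<le> n"
    using n k by (subst grid_less_iff) auto
  have IH: "foldl (debt_step (grid M n)) 0 (pattern_demands M F r) = (if hi then 1/2 else 0)"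
    using Suc by (simp add: hi_def k_def)
  show ?case
  proof (cases "F k = F (k - 1)")
    case True
    have "foldl (debt_step (grid M n)) (if hi then 1/2 else 0) (change_block M F k) =
        (if hi then 1/2 else 0)"
      using True \<Delta> by (auto simp: change_block_def debt_step_def)
    moreover have "hi \<longleftrightarrow> n \<le> k - 1 \<or> F n = F (k - 1)"
      using True k by (cases "n = k") (auto simp: hi_def)
    ultimately show ?thesis
      using IH k by (simp add: k_def[symmetric])
  next
    case False
    have "foldl (debt_step (grid M n)) (if hi then 1/2 else 0) (change_block M F k) =
        (if k \<le> n \<and> hi then 0 else 1/2)"
      using False \<Delta> grid_bounds[of "k - 1" M] k
      by (simp add: change_block_def foldl_debt_step_toggle_block less[unfolded One_nat_def])
    moreover have "k \<le> n \<and> hi \<longleftrightarrow> \<not> (n \<le> k - 1 \<or> F n = F (k - 1))"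
      using False k by (cases "n = k") (auto simp: hi_def)
    ultimately have "foldl (debt_step (grid M n)) (if hi then 1/2 else 0) (change_block M F k) =
        (if n \<le> k - 1 \<or> F n = F (k - 1) then 1/2 else 0)"
      by presburger
    then show ?thesis
      using IH k by (simp add: k_def[symmetric])
  qed
qed

section \<open>Extension of a finite demand list by zero demand\<close>

definition padded :: "real list \<Rightarrow> nat \<Rightarrow> real" where
  "padded xs t = (if t - 1 < length xs then xs ! (t - 1) else 0)"

lemma padded_bounds: "set xs \<subseteq> {0..1} \<Longrightarrow> padded xs t \<in> {0..1}"
  using nth_mem[of "t - 1" xs] by (force simp: padded_def simp del: nth_mem)

text \<open>The debt is already below \<open>\<Delta>\<close>, so a zero demand triggers no
  order.\<close>

lemma debt_padded:
  assumes "\<Delta> > 0" "set xs \<subseteq> {0..1}" "n \<ge> length xs"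
  shows "debt \<Delta> (padded xs) n = foldl (debt_step \<Delta>) 0 xs"
  using assms(3)
proof (induction n rule: dec_induct)
  case base
  have "map (padded xs) [1..<Suc (length xs)] = xs"
    by (rule nth_equalityI) (auto simp: padded_def simp del: upt_Suc)
  then show ?case
    by (simp add: debt_def del: upt_Suc)
next
  case (step n)
  have "debt \<Delta> (padded xs) n < \<Delta>"
    using debt_bounds[of \<Delta> n "padded xs"] padded_bounds[OF assms(2)] assms(1) by simp
  moreover have "padded xs (Suc n) = 0"
    using step by (simp add: padded_def)
  ultimately show ?case
    using step by (simp add: debt_Suc debt_step_def)
qed

lemma debt_cong: "(\<And>t. t \<in> {1..n} \<Longrightarrow> d t = d' t) \<Longrightarrow> debt \<Delta> d n = debt \<Delta> d' n"
  by (induction n) (simp_all add: debt_Suc)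

lemma sum_debt_padded:
  fixes xs T \<Delta>
  defines "c \<equiv> foldl (debt_step \<Delta>) 0 xs"
  assumes \<Delta>: "0 < \<Delta>" "\<Delta> \<le> 1" and xs: "set xs \<subseteq> {0..1}" and len: "length xs \<le> T"
  shows "c * real (T - length xs) \<le> (\<Sum>n<T. debt \<Delta> (padded xs) n)"
    and "(\<Sum>n<T. debt \<Delta> (padded xs) n) \<le> real (length xs) + c * real (T - length xs)"
proof -
  let ?f = "debt \<Delta> (padded xs)"
  have bounds: "0 \<le> ?f n \<and> ?f n \<le> 1" for n
    using debt_bounds[of \<Delta> n "padded xs"] padded_bounds[OF xs] \<Delta> by force
  have "(\<Sum>n<T. ?f n) = (\<Sum>n<length xs. ?f n) + (\<Sum>n\<in>{length xs..<T}. ?f n)"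
    using sum.atLeastLessThan_concat[of 0 "length xs" T ?f] len by (simp add: atLeast0LessThan)
  also have "(\<Sum>n\<in>{length xs..<T}. ?f n) = (\<Sum>n\<in>{length xs..<T}. c)"
    using debt_padded[OF \<Delta>(1) xs] by (intro sum.cong) (auto simp: c_def)
  finally have eq: "(\<Sum>n<T. ?f n) = (\<Sum>n<length xs. ?f n) + c * real (T - length xs)"
    by simp
  have "0 \<le> (\<Sum>n<length xs. ?f n)"
    using bounds by (intro sum_nonneg) auto
  then show "c * real (T - length xs) \<le> (\<Sum>n<T. ?f n)"
    using eq by simp
  have "(\<Sum>n<length xs. ?f n) \<le> (\<Sum>n<length xs. 1)"
    using bounds by (intro sum_mono) auto
  then show "(\<Sum>n<T. ?f n) \<le> real (length xs) + c * real (T - length xs)"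
    using eq by simp
qed

section \<open>Shattering\<close>

lemma gamma_shattered_sS_loss_class:
  assumes b: "0 < b" and \<gamma>: "\<gamma> \<le> b / 16" and x1: "x1 \<le> Hlow" and Hlow: "Hlow \<le> - 1"
    and T: "8 * (4 * 2 ^ m + 1) \<le> T"
  shows "\<exists>ds. (\<forall>i\<in>{1..m}. ds i \<in> demand_seqs L T 1) \<and>
    gamma_shattered \<gamma> (sS_loss_class L T 0 b 0 x1 Hlow \<infinity>) m ds"
proof -
  define M :: nat where "M = 2 ^ m"
  have "card (Pow {1..m}) = M"
    by (simp add: card_Pow M_def)
  then obtain g where g: "bij_betw g {1..M} (Pow {1..m})"
    using ex_bij_betw_nat_finite_1[of "Pow {1..m}"] by auto
  \<comment> \<open>After all \<open>M\<close> blocks the debt records agreement with index 0.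
    Making the pattern true there turns agreement into \<open>i \<in> g n\<close>.\<close>
  define xs where "xs i = pattern_demands M (\<lambda>n. n = 0 \<or> i \<in> g n) M" for i
  define ds where "ds i = restrict (padded (xs i)) {1..T + L}" for i
  define D where "D i = (\<Sum>n<T. \<Sum>t\<in>{Suc n..Suc n + L}. ds i t)" for i
  \<comment> \<open>The pattern fills at most \<open>T / 8\<close> periods, so the average debt is
    at least \<open>1/2 * 7/8 = 7/16\<close> for \<open>i \<in> A\<close> and at most
    \<open>1/8\<close> otherwise. The level \<open>5/16\<close> is more than \<open>1/16\<close>
    away from both.\<close>
  define \<tau> where "\<tau> i = b / real T * D i + 5 / 16 * b" for i
  have xs: "set (xs i) \<subseteq> {0..1}" "length (xs i) = 4 * M + 1" for i
    by (simp_all add: xs_def set_pattern_demands length_pattern_demands)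
  have T': "8 * (4 * M + 1) \<le> T" "T > 0"
    using T by (auto simp: M_def)
  have T'': "8 * (4 * real M + 1) \<le> real T"
    using of_nat_mono[OF T'(1), where ?'a = real] by simp
  have ds: "ds i \<in> demand_seqs L T 1" for i
    unfolding demand_seqs_def ds_def using padded_bounds[OF xs(1)[of i]]
    by (simp only: restrict_PiE_iff) blast
  have "\<exists>f\<in>sS_loss_class L T 0 b 0 x1 Hlow \<infinity>.
      (\<forall>i\<in>A. f (ds i) > \<tau> i + \<gamma>) \<and> (\<forall>i\<in>{1..m} - A. f (ds i) \<le> \<tau> i - \<gamma>)"
    if A: "A \<subseteq> {1..m}" for A
  proof -
    obtain n where n: "n \<in> {1..M}" "g n = A"
      using bij_betw_imp_surj_on[OF g] A by (metis PowI imageE)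
    define \<Delta> where "\<Delta> = grid M n"
    have \<Delta>: "0 < \<Delta>" "\<Delta> \<le> 1"
      using grid_bounds[of n M] n by (auto simp: \<Delta>_def)
    define f where "f = loss L T 0 b 0 x1 (sS_policy (- \<Delta>, 0))"
    have "f \<in> sS_loss_class L T 0 b 0 x1 Hlow \<infinity>"
      unfolding f_def sS_loss_class_def sS_params_def using \<Delta> Hlow by (intro imageI) auto
    moreover have f_eq: "f (ds i) = b / real T * D i + b * ((\<Sum>k<T. debt \<Delta> (padded (xs i)) k) / real T)" for i
    proof -
      have "f (ds i) = b / real T * (D i + (\<Sum>k<T. debt \<Delta> (ds i) k))"
        unfolding f_def D_def using \<Delta> x1 Hlow ds[of i]
        by (intro loss_order_up_to_0) (auto simp: demand_seqs_def PiE_iff)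
      also have "(\<Sum>k<T. debt \<Delta> (ds i) k) = (\<Sum>k<T. debt \<Delta> (padded (xs i)) k)"
        by (intro sum.cong refl debt_cong) (auto simp: ds_def)
      finally show ?thesis
        by (simp add: algebra_simps)
    qed
    have final: "foldl (debt_step \<Delta>) 0 (xs i) = (if i \<in> A then 1/2 else 0)" for i
      using foldl_debt_step_pattern_demands[OF n(1) order_refl] n by (auto simp: xs_def \<Delta>_def)
    have len: "length (xs i) \<le> T" for i
      using xs(2) T' by simp
    have "f (ds i) > \<tau> i + \<gamma>" if "i \<in> A" for i
    proof -
      have "(\<Sum>k<T. debt \<Delta> (padded (xs i)) k) \<ge> 1/2 * real (T - (4 * M + 1))"
        using sum_debt_padded(1)[OF \<Delta> xs(1) len, of i] that by (simp add: final xs(2))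
      also have "real (T - (4 * M + 1)) = real T - (4 * real M + 1)"
        using T' by (subst of_nat_diff) auto
      finally have "(\<Sum>k<T. debt \<Delta> (padded (xs i)) k) \<ge> 7/16 * real T"
        using T'' by simp
      then have "(\<Sum>k<T. debt \<Delta> (padded (xs i)) k) / real T \<ge> 7/16"
        using T' by (simp add: field_simps)
      then have "b * ((\<Sum>k<T. debt \<Delta> (padded (xs i)) k) / real T) \<ge> b * (7/16)"
        using b by (intro mult_left_mono) auto
      then show ?thesis
        using b \<gamma> unfolding f_eq \<tau>_def by linarith
    qed
    moreover have "f (ds i) \<le> \<tau> i - \<gamma>" if "i \<in> {1..m} - A" for i
    proof -
      have "(\<Sum>k<T. debt \<Delta> (padded (xs i)) k) \<le> 4 * real M + 1"
        using sum_debt_padded(2)[OF \<Delta> xs(1) len, of i] that by (simp add: final xs(2))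
      then have "(\<Sum>k<T. debt \<Delta> (padded (xs i)) k) \<le> 1/8 * real T"
        using T'' by simp
      then have "(\<Sum>k<T. debt \<Delta> (padded (xs i)) k) / real T \<le> 1/8"
        using T' by (simp add: field_simps)
      then have "b * ((\<Sum>k<T. debt \<Delta> (padded (xs i)) k) / real T) \<le> b * (1/8)"
        using b by (intro mult_left_mono) auto
      then show ?thesis
        using b \<gamma> unfolding f_eq \<tau>_def by linarith
    qed
    ultimately show ?thesis
      by blast
  qed
  then show ?thesis
    using ds unfolding gamma_shattered_def by blast
qed

lemma pseudo_gamma_dim_ge:
  assumes "\<forall>i\<in>{1..m}. ds i \<in> X" "gamma_shattered \<gamma> F m ds"
  shows "enat m \<le> pseudo_gamma_dim \<gamma> X F"
  unfolding pseudo_gamma_dim_def using assms by (intro Sup_upper) auto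

section \<open>Logarithmic growth of the shattered size\<close>

lemma exists_exponent:
  assumes "3 ^ 14 \<le> T"
  shows "\<exists>m::nat. 8 * (4 * 2 ^ m + 1) \<le> T \<and> ln (real T) / 2 \<le> real m"
proof -
  have T: "real T \<ge> 3 ^ 14"
    using assms by (metis of_nat_le_iff of_nat_numeral of_nat_power)
  have "exp (14::real) = exp 1 ^ 14"
    by (simp add: exp_of_nat_mult[symmetric])
  also have "\<dots> \<le> 3 ^ 14"
    using exp_le by (intro power_mono) auto
  finally have "exp 14 \<le> real T"
    using T by simp
  then have ln14: "14 \<le> ln (real T)"
    using T by (subst ln_ge_iff) auto
  \<comment> \<open>Subtracting 6 gives \<open>2 ^ m \<le> T / 64\<close>. Rounding down costs at
    most 1 more, and \<open>ln T - 7 \<ge> ln T / 2\<close> because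
    \<open>ln T \<ge> 14\<close>.\<close>
  define m where "m = nat \<lfloor>log 2 (real T) - 6\<rfloor>"
  have "ln (real T) * ln 2 \<le> ln (real T) * 1"
    using ln14 ln_2_less_1 by (intro mult_left_mono) auto
  then have log: "ln (real T) \<le> log 2 (real T)"
    by (simp add: log_def field_simps)
  have m: "real m \<le> log 2 (real T) - 6" "log 2 (real T) - 7 \<le> real m"
    unfolding m_def using log ln14 by linarith+
  have "2 ^ m = 2 powr real m"
    by (simp add: powr_realpow)
  also have "\<dots> \<le> 2 powr (log 2 (real T) - 6)"
    using m by (intro powr_mono) auto
  also have "\<dots> = real T / 64"
    using T by (simp add: powr_diff)
  finally have "64 * 2 ^ m \<le> real T"
    by simp
  then have "64 * 2 ^ m \<le> T"
    by (metis of_nat_le_iff of_nat_mult of_nat_numeral of_nat_power)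
  moreover have "8 * (4 * 2 ^ m + 1) \<le> 64 * (2 ^ m :: nat)"
    by simp
  ultimately show ?thesis
    using m log ln14 by (intro exI[of _ m] conjI) linarith+
qed

theorem theorem3:
  "\<exists>(C :: real) > 0. \<exists>(T0 :: nat) > 0.
     \<forall>(b :: real) (L :: nat) (T :: nat) (\<gamma> :: real) (Hlow :: real) (x1 :: real).
       0 < b \<longrightarrow> b \<le> 1 / 2 \<longrightarrow> T0 \<le> T \<longrightarrow> 0 \<le> \<gamma> \<longrightarrow> \<gamma> \<le> b / 16 \<longrightarrow>
       Hlow \<le> - 1 \<longrightarrow> x1 \<le> 0 \<longrightarrow> x1 \<le> Hlow \<longrightarrow>
       ereal (C * (ln (real T) / ln (ln (real T))))
         \<le> ereal_of_enat (pseudo_gamma_dim \<gamma> (demand_seqs L T 1)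
              (sS_loss_class L T 0 b 0 x1 Hlow \<infinity>))"
proof (intro exI[of _ "1/2::real"] exI[of _ "3 ^ 14 :: nat"] conjI allI impI)
  fix b \<gamma> Hlow x1 :: real and L T :: nat
  assume b: "0 < b" and T: "3 ^ 14 \<le> T" and \<gamma>: "\<gamma> \<le> b / 16"
    and Hlow: "Hlow \<le> - 1" and x1: "x1 \<le> Hlow"
  let ?F = "sS_loss_class L T 0 b 0 x1 Hlow \<infinity>"
  obtain m :: nat where m: "8 * (4 * 2 ^ m + 1) \<le> T" "ln (real T) / 2 \<le> real m"
    using exists_exponent[OF T] by blast
  \<comment> \<open>Once \<open>T\<close> is at least \<open>exp (exp 1)\<close>, the denominator
    \<open>ln (ln T)\<close> is at least 1, so the bound \<open>ln T / 2\<close> suffices.\<close>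
  have "exp (exp 1) \<le> exp (3::real)"
    using exp_le by simp
  also have "\<dots> = exp 1 ^ 3"
    by (simp add: exp_of_nat_mult[symmetric])
  also have "\<dots> \<le> (3::real) ^ 3"
    using exp_le by (intro power_mono) auto
  also have "\<dots> \<le> real T"
    using T by simp
  finally have "exp 1 \<le> ln (real T)"
    using T by (subst ln_ge_iff) auto
  then have ln: "0 < ln (real T)"
    using exp_gt_zero[of "1::real"] by linarith
  then have lnln: "1 \<le> ln (ln (real T))"
    using \<open>exp 1 \<le> ln (real T)\<close> by (simp add: ln_ge_iff)
  have "ln (real T) / ln (ln (real T)) \<le> ln (real T) / 1"
    using lnln ln by (intro divide_left_mono mult_pos_pos) linarith+
  then have "1/2 * (ln (real T) / ln (ln (real T))) \<le> real m"
    using m(2) by linarith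
  moreover obtain ds where "\<forall>i\<in>{1..m}. ds i \<in> demand_seqs L T 1" "gamma_shattered \<gamma> ?F m ds"
    using gamma_shattered_sS_loss_class[OF b \<gamma> x1 Hlow m(1)] by blast
  then have "enat m \<le> pseudo_gamma_dim \<gamma> (demand_seqs L T 1) ?F"
    by (rule pseudo_gamma_dim_ge)
  then have "ereal_of_enat (enat m) \<le> ereal_of_enat (pseudo_gamma_dim \<gamma> (demand_seqs L T 1) ?F)"
    by (simp only: ereal_of_enat_le_iff)
  ultimately show "ereal (1/2 * (ln (real T) / ln (ln (real T))))
      \<le> ereal_of_enat (pseudo_gamma_dim \<gamma> (demand_seqs L T 1) ?F)"
    by (metis ereal_less_eq(3) ereal_of_enat_simps(1) order_trans)
qed simp_all

end
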